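(* Let $q$ be a prime power and let $f \in \mathbb{F}_q[x]$ be an irreducible polynomial over $\mathbb{F}_q$ of degree $m$. Let $\alpha \in \mathbb{F}_{q^m}$ be a root of $f$. Then $\mathrm{Ord}(f) = \mathrm{Ord}(\alpha)$, where $\mathrm{Ord}(f)$ is the $\mathbb{F}_q$-Order of the polynomial $f$ and $\mathrm{Ord}(\alpha)$ is the $\mathbb{F}_q$-Order of the element $\alpha$.
   Context: For $g(x)=\sum_{i} a_i x^i \in \mathbb{F}_q[x]$ and $\beta$ in an extension field of $\mathbb{F}_q$, write $g\circ\beta = \sum_i a_i\beta^{q^i}$; similarly $g\circ x = \sum_i a_i x^{q^i}\in\mathbb{F}_q[x]$ (the linearized $q$-associate of $g$). $\mathbb{F}_q$-Order of an element: for $\alpha\in\mathbb{F}_{q^n}$, $\mathrm{Ord}(\alpha)$ is the unique monic polynomial $g\in\mathbb{F}_q[x]$ of least degree such that $g\circ\alpha=0$. $\mathbb{F}_q$-Order of a polynomial: for $f\in\mathbb{F}_q[x]$ of degree at least $1$, $\mathrm{Ord}(f)$ is the monic polynomial $g\in\mathbb{F}_q[x]$ of least degree such that $f \mid g\circ x$ in $\mathbb{F}_q[x]$. *)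

theory Defs
  imports "Jordan_Normal_Form.Char_Poly" "HOL-Library.Cardinality"
begin

text \<open>The base field with \<open>q\<close> elements is a finite field type \<open>'a\<close>, so \<open>q\<close> is \<open>CARD('a)\<close>
  (automatically a prime power). An extension field is a field type \<open>'b\<close> together with an
  embedding \<open>\<iota> :: 'a \<Rightarrow> 'b\<close> satisfying \<^term>\<open>field_hom \<iota>\<close>; the dependence on \<open>\<iota>\<close> is made explicit.\<close>

definition q_action :: "('a::{finite,field} \<Rightarrow> 'b::field) \<Rightarrow> 'a poly \<Rightarrow> 'b \<Rightarrow> 'b" where
  "q_action \<iota> g \<beta> = (\<Sum>i\<le>degree g. \<iota> (coeff g i) * \<beta> ^ (CARD('a) ^ i))"

definition q_associate :: "'a::{finite,field} poly \<Rightarrow> 'a poly" where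
  "q_associate g = (\<Sum>i\<le>degree g. monom (coeff g i) (CARD('a) ^ i))"

definition Ord_elem :: "('a::{finite,field} \<Rightarrow> 'b::field) \<Rightarrow> 'b \<Rightarrow> 'a poly" where
  "Ord_elem \<iota> \<alpha> = (THE g. is_arg_min degree (\<lambda>g. monic g \<and> q_action \<iota> g \<alpha> = 0) g)"

definition Ord_poly :: "'a::{finite,field} poly \<Rightarrow> 'a poly" where
  "Ord_poly f = (THE g. is_arg_min degree (\<lambda>g. monic g \<and> f dvd q_associate g) g)"

text \<open>The remaining lemmas show that both definite descriptions are well defined
  (for elements of finite extensions and for nonzero polynomials, respectively).\<close>

lemma ex1_least_monic:
  fixes P :: "'a::field poly \<Rightarrow> bool"
  assumes ex: "\<exists>p. p \<noteq> 0 \<and> P p"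
    and diff: "\<And>p r. P p \<Longrightarrow> P r \<Longrightarrow> P (p - r)"
    and smult: "\<And>c p. P p \<Longrightarrow> P (Polynomial.smult c p)"
  shows "\<exists>!g. is_arg_min degree (\<lambda>g. monic g \<and> P g) g"
proof -
  have norm: "\<exists>r. monic r \<and> P r \<and> degree r = degree p" if "p \<noteq> 0" "P p" for p
    using that smult[OF that(2), of "inverse (lead_coeff p)"]
    by (intro exI[of _ "Polynomial.smult (inverse (lead_coeff p)) p"]) auto
  have min_degree: "degree g \<le> degree h"
    if "is_arg_min degree (\<lambda>g. monic g \<and> P g) g" "monic h" "P h" for g h
    using that by (auto simp: is_arg_min_def not_less)
  show ?thesis
  proof (rule ex_ex1I)
    obtain p where "monic p \<and> P p" using ex norm by blast
    then have "\<exists>g. (monic g \<and> P g) \<and> (\<forall>h. monic h \<and> P h \<longrightarrow> degree g \<le> degree h)"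
      by (rule ex_has_least_nat)
    then show "\<exists>g. is_arg_min degree (\<lambda>g. monic g \<and> P g) g"
      by (auto simp: is_arg_min_def not_less)
  next
    fix g h
    assume g: "is_arg_min degree (\<lambda>g. monic g \<and> P g) g"
      and h: "is_arg_min degree (\<lambda>g. monic g \<and> P g) h"
    then have gh: "monic g" "P g" "monic h" "P h" by (auto simp: is_arg_min_def)
    have deg: "degree g = degree h"
      using min_degree[OF g gh(3,4)] min_degree[OF h gh(1,2)] by simp
    show "g = h"
    proof (rule ccontr)
      assume "g \<noteq> h"
      then obtain r where r: "monic r" "P r" "degree r = degree (g - h)"
        using norm[of "g - h"] diff gh by auto
      have le: "degree g \<le> degree (g - h)" using min_degree[OF g r(1,2)] r(3) by simp
      have "degree (g - h) \<le> degree g" using degree_diff_le[of g "degree g" h] deg by simp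
      then have "coeff (g - h) (degree (g - h)) = 0" using le gh(1,3) deg by simp
      then have "g - h = 0" by (simp only: leading_coeff_0_iff)
      then show False using \<open>g \<noteq> h\<close> by simp
    qed
  qed
qed

lemma ex_nonzero_kernel:
  fixes F :: "'a::field poly \<Rightarrow> 'c::ab_group_add"
  assumes "finite (range F)" and "\<And>p r. F (p - r) = F p - F r"
  shows "\<exists>p. p \<noteq> 0 \<and> F p = 0"
proof -
  have "inj (\<lambda>n. monom (1::'a) n)" by (rule injI) (simp add: monom_eq_iff')
  then have "infinite (UNIV :: 'a poly set)" 
    using finite_imageD[of "\<lambda>n. monom (1::'a) n" UNIV] finite_subset[OF subset_UNIV] infinite_UNIV_nat
    by blast
  then have "\<not> inj F" using assms(1) by (auto dest: finite_imageD)
  then obtain p r where "p \<noteq> r" "F p = F r" by (auto simp: inj_def)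
  then show ?thesis using assms(2) by (intro exI[of _ "p - r"]) simp
qed

context
  fixes \<iota> :: "'a::{finite,field} \<Rightarrow> 'b::field"
  assumes hom: "field_hom \<iota>"
begin

interpretation field_hom \<iota> by (fact hom)

lemma q_action_bound:
  assumes "degree g \<le> n"
  shows "q_action \<iota> g \<beta> = (\<Sum>i\<le>n. \<iota> (coeff g i) * \<beta> ^ (CARD('a) ^ i))"
  unfolding q_action_def using assms
  by (intro sum.mono_neutral_left) (auto simp: coeff_eq_0)

lemma q_action_diff: "q_action \<iota> (g - h) \<beta> = q_action \<iota> g \<beta> - q_action \<iota> h \<beta>"
proof -
  define n where "n = max (degree g) (degree h)"
  have "degree (g - h) \<le> n" "degree g \<le> n" "degree h \<le> n"
    by (auto simp: n_def intro: degree_diff_le)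
  then show ?thesis
    by (simp add: q_action_bound hom_minus algebra_simps sum_subtractf)
qed

lemma q_action_smult: "q_action \<iota> (Polynomial.smult c g) \<beta> = \<iota> c * q_action \<iota> g \<beta>"
  by (simp add: q_action_bound[of _ "degree g"] degree_smult_le hom_mult sum_distrib_left mult.assoc)

end

lemma q_associate_bound:
  fixes g :: "'a::{finite,field} poly"
  assumes "degree g \<le> n"
  shows "q_associate g = (\<Sum>i\<le>n. monom (coeff g i) (CARD('a) ^ i))"
  unfolding q_associate_def using assms
  by (intro sum.mono_neutral_left) (auto simp: coeff_eq_0)

lemma q_associate_diff: "q_associate (g - h) = q_associate g - q_associate h"
proof -
  define n where "n = max (degree g) (degree h)"
  have "degree (g - h) \<le> n" "degree g \<le> n" "degree h \<le> n"
    by (auto simp: n_def intro: degree_diff_le)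
  then show ?thesis
    by (simp add: q_associate_bound sum_subtractf flip: diff_monom)
qed

lemma q_associate_smult: "q_associate (Polynomial.smult c g) = Polynomial.smult c (q_associate g)"
  by (simp add: q_associate_bound[of _ "degree g"] degree_smult_le smult_sum2 smult_monom)

lemma Ord_elem_well_defined:
  fixes \<iota> :: "'a::{finite,field} \<Rightarrow> 'b::{finite,field}"
  assumes "field_hom \<iota>"
  shows "\<exists>!g. is_arg_min degree (\<lambda>g. monic g \<and> q_action \<iota> g \<alpha> = 0) g"
proof (rule ex1_least_monic)
  show "\<exists>p. p \<noteq> 0 \<and> q_action \<iota> p \<alpha> = 0"
    by (rule ex_nonzero_kernel) (auto simp: q_action_diff[OF assms])
qed (simp_all add: q_action_diff[OF assms] q_action_smult[OF assms])

lemma Ord_poly_well_defined: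
  fixes f :: "'a::{finite,field} poly"
  assumes "f \<noteq> 0"
  shows "\<exists>!g. is_arg_min degree (\<lambda>g. monic g \<and> f dvd q_associate g) g"
proof (rule ex1_least_monic)
  have "range (\<lambda>g. q_associate g mod f) \<subseteq> {r. degree r \<le> degree f}"
  proof
    fix r assume "r \<in> range (\<lambda>g. q_associate g mod f)"
    then obtain g where "r = q_associate g mod f" by blast
    then show "r \<in> {r. degree r \<le> degree f}"
      using degree_mod_less[OF assms, of "q_associate g"] by auto
  qed
  moreover have "finite {r :: 'a poly. degree r \<le> degree f}"
  proof (rule finite_subset)
    show "{r :: 'a poly. degree r \<le> degree f}
            \<subseteq> Poly ` {xs. set xs \<subseteq> UNIV \<and> length xs \<le> Suc (degree f)}"
    proof
      fix r :: "'a poly"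
      assume "r \<in> {r. degree r \<le> degree f}"
      then have "length (coeffs r) \<le> Suc (degree f)" by (cases "r = 0") (auto simp: length_coeffs)
      then show "r \<in> Poly ` {xs. set xs \<subseteq> UNIV \<and> length xs \<le> Suc (degree f)}"
        by (intro image_eqI[of _ _ "coeffs r"]) auto
    qed
  qed (intro finite_imageI finite_lists_length_le finite)
  ultimately have "finite (range (\<lambda>g. q_associate g mod f))" by (rule finite_subset)
  then show "\<exists>p. p \<noteq> 0 \<and> f dvd q_associate p"
    using ex_nonzero_kernel[of "\<lambda>g. q_associate g mod f"]
    by (simp add: q_associate_diff poly_mod_diff_left mod_eq_0_iff_dvd)
qed (simp_all add: q_associate_diff q_associate_smult dvd_smult)

end

theory Submission
  imports Defs
begin

text \<open>A least-degree nonzero polynomial vanishing at \<open>\<alpha>\<close> divides every polynomial vanishing at \<open>\<alpha>\<close>,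
  so it is associated to the irreducible \<open>f\<close>: a polynomial is divisible by \<open>f\<close> iff it vanishes at
  \<open>\<alpha>\<close>. As the linearized \<open>q\<close>-associate of \<open>g\<close> evaluates at \<open>\<alpha>\<close> to \<open>g \<circ> \<alpha>\<close>, both orders
  minimize the degree over the same set of polynomials.\<close>

text \<open>These closure rules make the polynomials vanishing at a given point an ideal.\<close>

lemma poly_map_poly_hom:
  assumes "field_hom (\<iota> :: 'a::field \<Rightarrow> 'b::field)"
  shows poly_map_poly_diff: "poly (map_poly \<iota> (p - r)) x = poly (map_poly \<iota> p) x - poly (map_poly \<iota> r) x"
    and poly_map_poly_mult: "poly (map_poly \<iota> (p * r)) x = poly (map_poly \<iota> p) x * poly (map_poly \<iota> r) x"
proof -
  interpret field_hom \<iota> by (fact assms)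
  interpret mp: map_poly_inj_idom_hom \<iota> ..
  show "poly (map_poly \<iota> (p - r)) x = poly (map_poly \<iota> p) x - poly (map_poly \<iota> r) x"
    by (simp add: mp.hom_minus)
  show "poly (map_poly \<iota> (p * r)) x = poly (map_poly \<iota> p) x * poly (map_poly \<iota> r) x"
    by (simp add: mp.hom_mult)
qed

lemma irreducible_dvd_iff_root:
  fixes f :: "'a::field poly" and \<iota> :: "'a \<Rightarrow> 'b::field"
  assumes "irreducible f" "field_hom \<iota>" and root: "poly (map_poly \<iota> f) \<alpha> = 0"
  shows "f dvd p \<longleftrightarrow> poly (map_poly \<iota> p) \<alpha> = 0"
proof
  interpret field_hom \<iota> by (fact assms)
  note hom = poly_map_poly_hom[OF assms(2)]
  show "f dvd p \<Longrightarrow> poly (map_poly \<iota> p) \<alpha> = 0"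
    using root by (auto simp: hom)
  assume p: "poly (map_poly \<iota> p) \<alpha> = 0"
  \<comment> \<open>\<open>d\<close> is the minimal polynomial of \<alpha> up to a unit;
    \<open>f\<close> itself shows that candidates exist.\<close>
  obtain d where d: "d \<noteq> 0" "poly (map_poly \<iota> d) \<alpha> = 0"
    and least: "\<And>h. h \<noteq> 0 \<Longrightarrow> poly (map_poly \<iota> h) \<alpha> = 0 \<Longrightarrow> degree d \<le> degree h"
    using ex_has_least_nat[of "\<lambda>h. h \<noteq> 0 \<and> poly (map_poly \<iota> h) \<alpha> = 0" f degree]
      root \<open>irreducible f\<close> by (auto simp: irreducible_def)
  have d_dvd: "d dvd h" if h: "poly (map_poly \<iota> h) \<alpha> = 0" for h
  proof -
    have "poly (map_poly \<iota> (h mod d)) \<alpha> = 0"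
      using h d(2) by (simp add: minus_div_mult_eq_mod[symmetric] hom)
    then have "h mod d = 0"
      using least[of "h mod d"] degree_mod_less[OF d(1), of h] by force
    then show ?thesis by (simp add: mod_eq_0_iff_dvd)
  qed
  obtain c where c: "f = d * c" using d_dvd[OF root] by blast
  \<comment> \<open>A unit cannot vanish at \<alpha>, so irreducibility makes the cofactor
    \<open>c\<close> the unit in \<open>f = d * c\<close>.\<close>
  have "\<not> d dvd 1"
  proof
    assume "d dvd 1"
    then obtain e where "1 = d * e" by blast
    moreover have "poly (map_poly \<iota> (d * e)) \<alpha> = 0" using d(2) by (simp add: hom)
    ultimately have "poly (map_poly \<iota> 1) \<alpha> = 0" by metis
    then show False by simp
  qed
  then have "c dvd 1" using irreducibleD[OF \<open>irreducible f\<close> c] by blast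
  then have "f dvd d" unfolding c by (simp add: mult_unit_dvd_iff)
  then show "f dvd p" using d_dvd[OF p] by (rule dvd_trans)
qed

lemma poly_q_associate:
  fixes \<iota> :: "'a::{finite,field} \<Rightarrow> 'b::field"
  assumes "field_hom \<iota>"
  shows "poly (map_poly \<iota> (q_associate g)) \<beta> = q_action \<iota> g \<beta>"
proof -
  interpret field_hom \<iota> by (fact assms)
  interpret mp: map_poly_inj_idom_hom \<iota> ..
  show ?thesis
    by (simp add: q_associate_def q_action_def mp.hom_sum poly_sum poly_monom)
qed

theorem proposition4:
  fixes f :: "'a::{finite,field} poly"
    and \<iota> :: "'a \<Rightarrow> 'b::{finite,field}"
    and \<alpha> :: 'b
    and m :: nat
  assumes "irreducible f"
    and "degree f = m"
    and "field_hom \<iota>"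
    and "CARD('b) = CARD('a) ^ m"
    and "poly (map_poly \<iota> f) \<alpha> = 0"
  shows "Ord_poly f = Ord_elem \<iota> \<alpha>"
  \<comment> \<open>The root criterion at \<open>q_associate g\<close> turns the predicate under one
    \<open>THE\<close> into that under the other, so both sides become the same term.\<close>
  by (simp add: Ord_poly_def Ord_elem_def irreducible_dvd_iff_root[OF assms(1,3,5)]
      poly_q_associate[OF assms(3)])

end
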